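(* No monitor can be strongly consistent for the Causal Observability Problem ($\mathbf{COP}$), even with an ideal log. That is, for every monitor operating under an ideal log, it is not the case that in all executions and for all operations $\mathit{op}_A,\mathit{op}_B$ one has $\mathrm{Precedes}(A,B)=\mathtt{true} \iff \mathit{op}_A <_H \mathit{op}_B$.
   Context: **Executions.** There are $N\ge 2$ asynchronous processes $p_1,\dots,p_N$ communicating through atomic shared memory. Every event occurs at a single point of real time, no two events are simultaneous, and $e\prec f$ means that event $e$ occurs before event $f$ in real time. An operation $\mathit{op}$ executed by a process has an invocation event $\mathrm{inv}(\mathit{op})$ and a later response event $\mathrm{res}(\mathit{op})$, called its true boundaries. The true boundaries are transfers of control between a process and its caller; they are not shared-memory steps. The real-time order is $\mathit{op}_A <_H \mathit{op}_B \iff \mathrm{res}(\mathit{op}_A)\prec \mathrm{inv}(\mathit{op}_B)$. Two operations are concurrent, $\mathit{op}_A\parallel \mathit{op}_B$, if neither precedes the other in $<_H$. **Monitors.** A monitor is a protocol that, for each operation $\mathit{op}$, makes the process executing $\mathit{op}$ invoke shared-memory objects (of any type, including objects of infinite consensus number) around the true boundaries of $\mathit{op}$. These invocations are called interface events. By convention a monitor is modelled as emitting exactly one interface event per boundary: $\widehat{\mathrm{inv}}(\mathit{op})$, associated with $\mathrm{inv}(\mathit{op})$, and $\widehat{\mathrm{res}}(\mathit{op})$, associated with $\mathrm{res}(\mathit{op})$. For each operation, the monitor prescribes the program order of the four events $\mathrm{inv}(\mathit{op}),\mathrm{res}(\mathit{op}),\widehat{\mathrm{inv}}(\mathit{op}),\widehat{\mathrm{res}}(\mathit{op})$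 at the executing process. The monitor answers $\mathrm{Precedes}(A,B)=\mathtt{true}$ iff $\widehat{\mathrm{res}}(\mathit{op}_A)\prec^{L}\widehat{\mathrm{inv}}(\mathit{op}_B)$, where $\prec^L$ is the happened-before order that the monitor has on interface events. **Ideal log.** The monitor operates under an ideal log if every interface event $e$ has a linearization point $\mathrm{lp}(e)$ (the instant at which it takes effect), and $e_1\prec^L e_2 \iff \mathrm{lp}(e_1)\prec \mathrm{lp}(e_2)$. Linearization points are distinct from the instants of all true boundaries. **Asynchrony.** There is no bound on relative process speeds, and processes share no synchronization restricting how their steps interleave: given operations on distinct processes, every interleaving of the per-process event sequences (true boundaries and linearization points of interface events) that respects each process's program order is an admissible execution. **$\mathbf{COP}$ properties of a monitor.** Complete: in every execution, for all $\mathit{op}_A,\mathit{op}_B$, $\mathit{op}_A<_H\mathit{op}_B \Rightarrow \mathrm{Precedes}(A,B)=\mathtt{true}$. Sound: in every execution, for all $\mathit{op}_A,\mathit{op}_B$, $\mathrm{Precedes}(A,B)=\mathtt{true}\Rightarrow \mathit{op}_A<_H\mathit{op}_B$. Strongly consistent: both complete and sound. *)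

theory Defs
  imports Complex_Main
begin

text \<open>
  An operation is an instance executed by one process; \<open>seqno\<close> only distinguishes
  different instances, and \<open>call\<close> is whatever the caller requests.  Every process may
  execute arbitrarily many operations.
\<close>

datatype 'c operation = Operation (proc: nat) (seqno: nat) (call: 'c)

datatype 'c boundary = Inv "'c operation" | Res "'c operation"

datatype 'c interface = InvHat "'c operation" | ResHat "'c operation"

datatype 'c event = Boundary "'c boundary" | Interface "'c interface"

definition events_of :: "'c operation \<Rightarrow> 'c event set" where
  "events_of a =
     {Boundary (Inv a), Boundary (Res a), Interface (InvHat a), Interface (ResHat a)}"

text \<open>
  Instants are real numbers.  An execution fixes the instant of every true boundary and the
  linearization point of every interface event of its operations; values of \<open>btime\<close> and
  \<open>lp\<close> for operations outside \<open>ops\<close> are meaningless.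
\<close>

record 'c execution =
  ops :: "'c operation set"
  btime :: "'c boundary \<Rightarrow> real"
  lp :: "'c interface \<Rightarrow> real"

fun instant :: "'c execution \<Rightarrow> 'c event \<Rightarrow> real" where
  "instant E (Boundary b) = btime E b"
| "instant E (Interface i) = lp E i"

definition events :: "'c execution \<Rightarrow> 'c event set" where
  "events E = (\<Union>a\<in>ops E. events_of a)"

definition interface_events :: "'c execution \<Rightarrow> 'c interface set" where
  "interface_events E = {i. Interface i \<in> events E}"

text \<open>
  A monitor prescribes, for each operation, the order in which the executing process performs
  its four events, and it has an order on the interface events of each execution.  The
  program order is constrained only by the invocation preceding the response: the interface
  events may be placed anywhere relative to the true boundaries.
\<close>

record 'c monitor =
  program :: "'c operation \<Rightarrow> 'c event list"
  happened_before :: "'c execution \<Rightarrow> 'c interface \<Rightarrow> 'c interface \<Rightarrow> bool"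

definition is_monitor :: "nat \<Rightarrow> 'c monitor \<Rightarrow> bool" where
  "is_monitor N M \<longleftrightarrow>
     (\<forall>a. proc a \<in> {1..N} \<longrightarrow>
        distinct (program M a) \<and> set (program M a) = events_of a \<and>
        (\<exists>xs ys zs. program M a = xs @ Boundary (Inv a) # ys @ Boundary (Res a) # zs))"

text \<open>
  The executions of \<open>N\<close> processes under a monitor are all interleavings that respect the
  program order of each process: processes are sequential, so the events of two operations of
  one process do not interleave, and operations of distinct processes are not constrained
  relative to each other.  Infinite executions are allowed, with finitely many events up to
  any instant.
\<close>

definition admissible :: "nat \<Rightarrow> 'c monitor \<Rightarrow> 'c execution \<Rightarrow> bool" where
  "admissible N M E \<longleftrightarrow>
     (\<forall>a\<in>ops E. proc a \<in> {1..N}) \<and>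
     inj_on (instant E) (events E) \<and>
     (\<forall>t. finite {e \<in> events E. instant E e \<le> t}) \<and>
     (\<forall>a\<in>ops E. sorted_wrt (\<lambda>e f. instant E e < instant E f) (program M a)) \<and>
     (\<forall>a\<in>ops E. \<forall>b\<in>ops E. a \<noteq> b \<and> proc a = proc b \<longrightarrow>
        (\<forall>e\<in>events_of a. \<forall>f\<in>events_of b. instant E e < instant E f) \<or>
        (\<forall>e\<in>events_of a. \<forall>f\<in>events_of b. instant E f < instant E e))"

definition real_time_before :: "'c execution \<Rightarrow> 'c operation \<Rightarrow> 'c operation \<Rightarrow> bool" where
  "real_time_before E a b \<longleftrightarrow> btime E (Res a) < btime E (Inv b)"

definition Precedes ::
    "'c monitor \<Rightarrow> 'c execution \<Rightarrow> 'c operation \<Rightarrow> 'c operation \<Rightarrow> bool" where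
  "Precedes M E a b \<longleftrightarrow> happened_before M E (ResHat a) (InvHat b)"

text \<open>
  That every interface event has a linearization point, distinct from all true boundaries, is
  part of the notion of admissible execution.
\<close>

definition ideal_log :: "nat \<Rightarrow> 'c monitor \<Rightarrow> bool" where
  "ideal_log N M \<longleftrightarrow>
     (\<forall>E. admissible N M E \<longrightarrow>
        (\<forall>i\<in>interface_events E. \<forall>j\<in>interface_events E.
           happened_before M E i j \<longleftrightarrow> lp E i < lp E j))"

definition COP_complete :: "nat \<Rightarrow> 'c monitor \<Rightarrow> bool" where
  "COP_complete N M \<longleftrightarrow>
     (\<forall>E. admissible N M E \<longrightarrow>
        (\<forall>a\<in>ops E. \<forall>b\<in>ops E. real_time_before E a b \<longrightarrow> Precedes M E a b))"

definition COP_sound :: "nat \<Rightarrow> 'c monitor \<Rightarrow> bool" where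
  "COP_sound N M \<longleftrightarrow>
     (\<forall>E. admissible N M E \<longrightarrow>
        (\<forall>a\<in>ops E. \<forall>b\<in>ops E. Precedes M E a b \<longrightarrow> real_time_before E a b))"

definition COP_strongly_consistent :: "nat \<Rightarrow> 'c monitor \<Rightarrow> bool" where
  "COP_strongly_consistent N M \<longleftrightarrow> COP_complete N M \<and> COP_sound N M"

end

(* In the program of an operation a, the response of a and its interface event occur in some
   order.  Let another process execute a whole operation b between these two.  If the response
   comes first, a precedes b in real time but the log orders the invocation of b before the
   response of a, so the monitor is incomplete; otherwise the log orders a before b although
   the two operations are concurrent, so it is unsound. *)

theory Submission
  imports Defs
begin

text \<open>The instant of an event is its position in the list, which distinctness makes well
  defined.\<close>

lemma ex_strict_timing:
  assumes "distinct L"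
  obtains t :: "'a \<Rightarrow> real" where "sorted_wrt (\<lambda>e f. t e < t f) L"
proof
  let ?t = "\<lambda>e. real (the_inv_into {..<length L} ((!) L) e)"
  have "inj_on ((!) L) {..<length L}"
    using assms by (simp add: inj_on_nth)
  then have "?t (L ! i) = real i" if "i < length L" for i
    using that by (simp add: the_inv_into_f_f)
  then show "sorted_wrt (\<lambda>e f. ?t e < ?t f) L"
    by (simp add: sorted_wrt_iff_nth_less)
qed

lemma disjoint_events_of:
  "a \<noteq> b \<Longrightarrow> events_of a \<inter> events_of b = {}"
  by (auto simp: events_of_def)

text \<open>Asynchrony at work: inserting the whole program of \<open>b\<close> directly after
  \<open>e\<close> in that of \<open>a\<close> keeps both programs as subsequences, so the merged
  list is a legal interleaving of two processes.\<close>

lemma nested_execution: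
  assumes "is_monitor N M"
    and "proc a \<in> {1..N}" "proc b \<in> {1..N}" "proc a \<noteq> proc b"
    and a: "program M a = xs @ e # ys @ f # zs"
  obtains E where "admissible N M E" "ops E = {a, b}"
    "\<And>g. g \<in> events_of b \<Longrightarrow> instant E e < instant E g \<and> instant E g < instant E f"
proof -
  let ?L = "xs @ e # program M b @ ys @ f # zs"
  have da: "distinct (program M a)" "set (program M a) = events_of a"
    and db: "distinct (program M b)" "set (program M b) = events_of b"
    using assms(1-3) unfolding is_monitor_def by blast+
  have "set (program M a) \<inter> set (program M b) = {}"
    using disjoint_events_of[of a b] assms(4) da(2) db(2) by auto
  then have "distinct ?L"
    using da(1) db(1) unfolding a by auto
  then obtain t :: "'a event \<Rightarrow> real" where t: "sorted_wrt (\<lambda>e f. t e < t f) ?L"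
    using ex_strict_timing by blast
  \<comment> \<open>Both time components are read off the single timing \<open>t\<close>, so
    \<open>instant E\<close> is \<open>t\<close>.\<close>
  define E :: "'a execution" where
    "E = \<lparr>ops = {a, b}, btime = t \<circ> Boundary, lp = t \<circ> Interface\<rparr>"
  have inst: "instant E e = t e" for e
    by (cases e) (simp_all add: E_def)
  have evs: "events E = set ?L"
    using da(2) db(2) unfolding a events_def by (auto simp: E_def)
  have "sorted_wrt (<) (map t ?L)"
    using t unfolding sorted_wrt_map .
  then have "distinct (map t ?L)"
    using strict_sorted_iff by blast
  then have "inj_on t (set ?L)"
    unfolding distinct_map by blast
  moreover have "sorted_wrt (\<lambda>e f. t e < t f) (program M a)"
    "sorted_wrt (\<lambda>e f. t e < t f) (program M b)"
    using t unfolding a by (simp_all add: sorted_wrt_append)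
  \<comment> \<open>Local finiteness holds since there are finitely many events, and the
    sequentiality clause is vacuous since the two processes differ.\<close>
  ultimately have "admissible N M E"
    using assms(2-4) unfolding admissible_def inst evs by (auto simp: E_def)
  moreover have "t e < t g \<and> t g < t f" if "g \<in> events_of b" for g
    using t that unfolding db(2)[symmetric] by (simp add: sorted_wrt_append)
  ultimately show thesis
    using that[of E] inst by (simp add: E_def)
qed

theorem theorem12:
  fixes N :: nat and M :: "'c monitor"
  assumes "N \<ge> 2"
    and "is_monitor N M"
    and "ideal_log N M"
  shows "\<not> COP_strongly_consistent N M"
proof
  assume "COP_strongly_consistent N M"
  then have iff: "Precedes M E a b \<longleftrightarrow> real_time_before E a b"
    if "admissible N M E" "a \<in> ops E" "b \<in> ops E" for E a b
    using that unfolding COP_strongly_consistent_def COP_complete_def COP_sound_def by blast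
  \<comment> \<open>The ideal log and strong consistency together force the log and real time to
    agree on \<open>a\<close> and \<open>b\<close>; the nested executions violate this.\<close>
  have log: "lp E (ResHat a) < lp E (InvHat b) \<longleftrightarrow> btime E (Res a) < btime E (Inv b)"
    if "admissible N M E" "ops E = {a, b}" for E a b
  proof -
    have "ResHat a \<in> interface_events E" "InvHat b \<in> interface_events E"
      using that(2) by (auto simp: interface_events_def events_def events_of_def)
    then show ?thesis
      using iff[of E a b] assms(3) that
      unfolding ideal_log_def Precedes_def real_time_before_def by simp
  qed
  \<comment> \<open>Processes 1 and 2 both exist because \<open>N \<ge> 2\<close>; the call is
    arbitrary.\<close>
  define a b :: "'c operation" where "a = Operation 1 0 undefined" and "b = Operation 2 0 undefined"
  have procs: "proc a \<in> {1..N}" "proc b \<in> {1..N}" "proc a \<noteq> proc b"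
    using assms(1) by (simp_all add: a_def b_def)
  have b: "Boundary (Inv b) \<in> events_of b" "Interface (InvHat b) \<in> events_of b"
    by (simp_all add: events_of_def)
  have "set (program M a) = events_of a"
    using assms(2) procs(1) unfolding is_monitor_def by blast
  then have mem: "Boundary (Res a) \<in> set (program M a)" "Interface (ResHat a) \<in> set (program M a)"
    by (simp_all add: events_of_def)
  obtain us vs where split: "program M a = us @ Boundary (Res a) # vs"
    using split_list[OF mem(1)] by blast
  then consider "Interface (ResHat a) \<in> set us" | "Interface (ResHat a) \<in> set vs"
    using mem(2) by auto
  then show False
  proof cases
    case 1
    then obtain xs ys where "us = xs @ Interface (ResHat a) # ys"
      using split_list by fast
    with split have "program M a = xs @ Interface (ResHat a) # ys @ Boundary (Res a) # vs"
      by simp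
    then obtain E where "admissible N M E" "ops E = {a, b}"
      "\<And>g. g \<in> events_of b \<Longrightarrow>
         instant E (Interface (ResHat a)) < instant E g \<and> instant E g < instant E (Boundary (Res a))"
      using nested_execution[OF assms(2) procs] by blast
    \<comment> \<open>At \<open>InvHat b\<close> the bounds make the left side of \<open>log\<close>
      true, at \<open>Inv b\<close> they make its right side false.\<close>
    then show False
      using log[of E a b] b by fastforce
  next
    case 2
    then obtain ys zs where "vs = ys @ Interface (ResHat a) # zs"
      using split_list by fast
    with split have "program M a = us @ Boundary (Res a) # ys @ Interface (ResHat a) # zs"
      by simp
    then obtain E where "admissible N M E" "ops E = {a, b}"
      "\<And>g. g \<in> events_of b \<Longrightarrow>
         instant E (Boundary (Res a)) < instant E g \<and> instant E g < instant E (Interface (ResHat a))"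
      using nested_execution[OF assms(2) procs] by blast
    \<comment> \<open>The same two instances now make the right side of \<open>log\<close> true and
      its left side false.\<close>
    then show False
      using log[of E a b] b by fastforce
  qed
qed

end
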